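(* Let $c\in(0,\infty)$ and let $X,Y,Z$ be real random variables with cumulative distribution functions $F_X,F_Y,F_Z$ satisfying $F_Z(t)\le F_Y(t)\le F_X(t)$ for all $t\in\mathbb{R}$. If there exists a coupling of $X$ and $Z$ under which $\mathbb{P}(|Z-X|\le c)=1$, then there exists a coupling of $X$ and $Y$ under which $\mathbb{P}(Y\in[X,X+c])=1$.
   Context: A coupling of two random variables (with specified distributions) is a pair of random variables defined on a common probability space having those distributions as marginals. *)

theory Defs
  imports "HOL-Probability.Probability"
begin

text \<open>
  A coupling of two real distributions \<open>\<mu>\<close>, \<open>\<nu>\<close>: real random variables \<open>U\<close>, \<open>V\<close> on a common
  probability space \<open>P\<close> with laws \<open>\<mu>\<close> and \<open>\<nu>\<close>. Measurability is required explicitly because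
  \<open>distr\<close> carries no information for non-measurable functions.

  The sample space type \<open>'p\<close> cannot be quantified inside a formula. In a hypothesis, an existence
  statement over couplings is therefore made with \<open>'p\<close> a free type variable, so that it covers
  couplings on every type; in a conclusion the coupling is asserted on the sample space type
  \<open>real \<times> real\<close>.
\<close>

definition is_coupling ::
  "'p measure \<Rightarrow> ('p \<Rightarrow> real) \<Rightarrow> ('p \<Rightarrow> real) \<Rightarrow> real measure \<Rightarrow> real measure \<Rightarrow> bool" where
  "is_coupling P U V \<mu> \<nu> \<longleftrightarrow>
     prob_space P \<and> U \<in> borel_measurable P \<and> V \<in> borel_measurable P \<and>
     distr P borel U = \<mu> \<and> distr P borel V = \<nu>"

end

theory Submission
  imports Defs
begin

text \<open>
  A coupling of \<open>\<mu>\<close> and \<open>\<nu>\<close> whose second component exceeds the first by an amount in \<open>[0, c]\<close> can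
  exist only if their distribution functions \<open>F\<close> and \<open>G\<close> satisfy \<open>G t \<le> F t \<le> G (t + c)\<close> for all \<open>t\<close>. These
  inequalities also suffice: they say precisely that the quantile functions \<open>q\<close> of \<open>\<mu>\<close> and \<open>r\<close> of
  \<open>\<nu>\<close> satisfy \<open>q \<le> r \<le> q + c\<close>, so evaluating both at a single uniform variable on \<open>(0, 1)\<close> gives
  the coupling (\<open>quantile_coupling\<close>).

  For \<open>X\<close> and \<open>Y\<close> the left inequality is \<open>F\<^sub>Y \<le> F\<^sub>X\<close>. The right one passes through \<open>Z\<close>: the given
  coupling has \<open>Z \<le> X + c\<close> almost surely, so \<open>F\<^sub>X t \<le> F\<^sub>Z (t + c)\<close> (\<open>cdf_shift_le_of_coupling\<close>), and
  \<open>F\<^sub>Z (t + c) \<le> F\<^sub>Y (t + c)\<close> by assumption.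
\<close>

lemma cdf_shift_le_of_coupling:
  assumes coup: "is_coupling P U W \<mu> \<nu>"
    and le: "AE \<omega> in P. W \<omega> \<le> U \<omega> + c"
  shows "cdf \<mu> t \<le> cdf \<nu> (t + c)"
proof -
  interpret prob_space P
    using coup by (simp add: is_coupling_def)
  have [measurable]: "U \<in> borel_measurable P" "W \<in> borel_measurable P"
    using coup by (auto simp: is_coupling_def)
  have "cdf \<mu> t = measure P {\<omega> \<in> space P. U \<omega> \<le> t}"
    using coup by (auto simp: is_coupling_def cdf_def measure_distr intro!: arg_cong[where f="measure P"])
  also have "\<dots> \<le> measure P {\<omega> \<in> space P. W \<omega> \<le> t + c}"
    using le by (intro finite_measure_mono_AE) auto
  also have "\<dots> = cdf \<nu> (t + c)"
    using coup by (auto simp: is_coupling_def cdf_def measure_distr intro!: arg_cong[where f="measure P"])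
  finally show ?thesis .
qed

text \<open>
  For \<open>0 < \<omega> < 1\<close>, the quantile at \<open>\<omega>\<close> is the least point at which the distribution function \<open>G\<close>
  reaches \<open>\<omega>\<close>, so it is at most \<open>x\<close> iff \<open>\<omega> \<le> G x\<close>. Through this Galois connection each pointwise inequality between shifted
  distribution functions turns into the reverse inequality between quantiles.
\<close>

lemma quantile_coupling:
  assumes "real_distribution \<mu>" and "real_distribution \<nu>"
    and below: "\<And>t. cdf \<nu> t \<le> cdf \<mu> t"
    and above: "\<And>t. cdf \<mu> t \<le> cdf \<nu> (t + c)"
  shows "\<exists>(Q :: (real \<times> real) measure) U V. is_coupling Q U V \<mu> \<nu> \<and>
           \<P>(\<omega> in Q. V \<omega> \<in> {U \<omega> .. U \<omega> + c}) = 1"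
proof -
  interpret \<mu>: cdf_distribution \<mu>
    unfolding cdf_distribution_def by fact
  interpret \<nu>: cdf_distribution \<nu>
    unfolding cdf_distribution_def by fact
  let ?\<Omega> = "restrict_space lborel {0<..<1} :: real measure"
  interpret \<Omega>: prob_space ?\<Omega>
    by (auto simp: space_restrict_space emeasure_restrict_space intro!: prob_spaceI)
  have [measurable]: "\<mu>.I \<in> borel_measurable ?\<Omega>" "\<nu>.I \<in> borel_measurable ?\<Omega>"
    using \<mu>.measurable_CI \<nu>.measurable_CI
    by (simp_all cong: measurable_cong_sets add: sets_restrict_space)
  have lower: "\<mu>.I \<omega> \<le> \<nu>.I \<omega>" if "\<omega> \<in> {0<..<1}" for \<omega>
  proof -
    have "\<omega> \<le> cdf \<nu> (\<nu>.I \<omega>)"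
      using \<nu>.pseudoinverse[of \<omega> "\<nu>.I \<omega>"] that by simp
    with below have "\<omega> \<le> cdf \<mu> (\<nu>.I \<omega>)"
      by (rule order_trans[rotated])
    then show ?thesis
      using \<mu>.pseudoinverse[of \<omega> "\<nu>.I \<omega>"] that by simp
  qed
  have upper: "\<nu>.I \<omega> \<le> \<mu>.I \<omega> + c" if "\<omega> \<in> {0<..<1}" for \<omega>
  proof -
    have "\<omega> \<le> cdf \<mu> (\<mu>.I \<omega>)"
      using \<mu>.pseudoinverse[of \<omega> "\<mu>.I \<omega>"] that by simp
    with above have "\<omega> \<le> cdf \<nu> (\<mu>.I \<omega> + c)"
      by (rule order_trans[rotated])
    then show ?thesis
      using \<nu>.pseudoinverse[of \<omega> "\<mu>.I \<omega> + c"] that by simp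
  qed
  \<comment> \<open>Pushing the uniform distribution forward to the plane turns the two quantile functions into the
    coordinate projections.\<close>
  define Q where "Q = distr ?\<Omega> (borel \<Otimes>\<^sub>M borel) (\<lambda>\<omega>. (\<mu>.I \<omega>, \<nu>.I \<omega>))"
  interpret Q: prob_space Q
    unfolding Q_def by (rule \<Omega>.prob_space_distr) measurable
  have [measurable_cong]: "sets Q = sets (borel \<Otimes>\<^sub>M borel)"
    by (simp add: Q_def)
  have "distr Q borel fst = \<mu>" "distr Q borel snd = \<nu>"
    using \<mu>.distr_I_eq_M \<nu>.distr_I_eq_M by (simp_all add: Q_def distr_distr comp_def)
  moreover have "AE \<omega> in Q. snd \<omega> \<in> {fst \<omega> .. fst \<omega> + c}"
    unfolding Q_def using lower upper
    by (subst AE_distr_iff) (auto simp: space_restrict_space intro!: AE_I2)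
  then have "\<P>(\<omega> in Q. snd \<omega> \<in> {fst \<omega> .. fst \<omega> + c}) = 1"
    by (subst Q.prob_Collect_eq_1) auto
  ultimately have "is_coupling Q fst snd \<mu> \<nu> \<and> \<P>(\<omega> in Q. snd \<omega> \<in> {fst \<omega> .. fst \<omega> + c}) = 1"
    by (simp add: is_coupling_def Q.prob_space_axioms)
  then show ?thesis
    by blast
qed

theorem corollary7p1:
  fixes c :: real
    and MX :: "'a measure" and MY :: "'b measure" and MZ :: "'d measure"
    and X :: "'a \<Rightarrow> real" and Y :: "'b \<Rightarrow> real" and Z :: "'d \<Rightarrow> real"
  assumes c_pos: "0 < c"
    and "prob_space MX" and "prob_space MY" and "prob_space MZ"
    and "X \<in> borel_measurable MX" and "Y \<in> borel_measurable MY" and "Z \<in> borel_measurable MZ"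
    and cdf_ZY: "\<And>t. cdf (distr MZ borel Z) t \<le> cdf (distr MY borel Y) t"
    and cdf_YX: "\<And>t. cdf (distr MY borel Y) t \<le> cdf (distr MX borel X) t"
    and coupling_XZ:
      "\<exists>(P :: 'p measure) U W. is_coupling P U W (distr MX borel X) (distr MZ borel Z) \<and>
         \<P>(\<omega> in P. \<bar>W \<omega> - U \<omega>\<bar> \<le> c) = 1"
  shows "\<exists>(Q :: (real \<times> real) measure) U V.
           is_coupling Q U V (distr MX borel X) (distr MY borel Y) \<and>
           \<P>(\<omega> in Q. V \<omega> \<in> {U \<omega> .. U \<omega> + c}) = 1"
proof -
  obtain P :: "'p measure" and U W
    where coup: "is_coupling P U W (distr MX borel X) (distr MZ borel Z)"
      and close: "\<P>(\<omega> in P. \<bar>W \<omega> - U \<omega>\<bar> \<le> c) = 1"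
    using coupling_XZ by blast
  interpret P: prob_space P
    using coup by (simp add: is_coupling_def)
  have [measurable]: "U \<in> borel_measurable P" "W \<in> borel_measurable P"
    using coup by (auto simp: is_coupling_def)
  have "AE \<omega> in P. \<bar>W \<omega> - U \<omega>\<bar> \<le> c"
    using close by (subst (asm) P.prob_Collect_eq_1) auto
  then have "AE \<omega> in P. W \<omega> \<le> U \<omega> + c"
    by eventually_elim simp
  with coup have "cdf (distr MX borel X) t \<le> cdf (distr MZ borel Z) (t + c)" for t
    by (rule cdf_shift_le_of_coupling)
  then have "cdf (distr MX borel X) t \<le> cdf (distr MY borel Y) (t + c)" for t
    using cdf_ZY order_trans by blast
  with cdf_YX show ?thesis
    using assms by (intro quantile_coupling prob_space.real_distribution_distr)
qed

end
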